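(* Let $\mathcal{A},\mathcal{B},\mathcal{A}',\mathcal{B}'\in\Lambda$ be such that $\mathcal{A}$ and $\mathcal{B}$ are independent, $\mathcal{A}'$ and $\mathcal{B}'$ are independent, and $\mathcal{A}+\mathcal{B}=\mathcal{A}'+\mathcal{B}'$. (i) There is at most one $\mathcal{X}\in\Lambda$ such that $\mathcal{A}+\mathcal{X}=\mathcal{A}'$ and $\mathcal{B}'+\mathcal{X}=\mathcal{B}$, namely $\mathcal{A}'\land\mathcal{B}$ (that is, if such an $\mathcal{X}$ exists, then $\mathcal{X}=\mathcal{A}'\land\mathcal{B}$). (ii) Let $\mathcal{X},\mathcal{Y}\in\Lambda$ be such that $\mathcal{A}+\mathcal{X}=\mathcal{A}'$ and $\mathcal{B}'+\mathcal{Y}=\mathcal{B}$. The following statements are equivalent: (a) There is $\mathcal{Z}\in\Lambda$ with $\mathcal{A}+\mathcal{Z}=\mathcal{A}'$ and $\mathcal{B}'+\mathcal{Z}=\mathcal{B}$. (b) $\mathcal{A}+(\mathcal{A}'\land\mathcal{B})+\mathcal{B}'=\mathcal{A}+\mathcal{B}$ ($=\mathcal{A}'+\mathcal{B}'$). (c) $\mathcal{X}\subset\mathcal{A}\lor(\mathcal{A}'\land\mathcal{B})$ and $\mathcal{Y}\subset\mathcal{B}'\lor(\mathcal{A}'\land\mathcal{B})$. (d) There is $\mathcal{X}'\in\Lambda$ with $\mathcal{X}'\subset\mathcal{B}$ and $\mathcal{A}+\mathcal{X}'=\mathcal{A}'$, and there is $\mathcal{Y}'\in\Lambda$ with $\mathcal{Y}'\subset\mathcal{A}'$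 and $\mathcal{B}'+\mathcal{Y}'=\mathcal{B}$. (e) $\mathbb{P}[B\vert\mathcal{A}']$ is $\mathcal{B}$-measurable for every $B\in\mathcal{B}$, and $\mathbb{P}[A'\vert\mathcal{B}]$ is $\mathcal{A}'$-measurable for every $A'\in\mathcal{A}'$.
   Context: $(\Omega,\mathcal{M},\mathbb{P})$ is a probability space ($\mathbb{P}$ itself need not be complete). $0_\Lambda:=\mathbb{P}^{-1}(\{0,1\})$ is the collection of all events of $\mathcal{M}$ having probability $0$ or $1$. A sub-$\sigma$-field of $\mathcal{M}$ is called complete if it contains $0_\Lambda$, and $\Lambda$ denotes the collection of all complete sub-$\sigma$-fields of $\mathcal{M}$. For $\mathcal{X},\mathcal{Y}\in\Lambda$: $\mathcal{X}\land\mathcal{Y}:=\mathcal{X}\cap\mathcal{Y}$; $\mathcal{X}\lor\mathcal{Y}:=\sigma(\mathcal{X}\cup\mathcal{Y})$; when $\mathcal{X}$ and $\mathcal{Y}$ are independent under $\mathbb{P}$, one writes $\mathcal{X}+\mathcal{Y}:=\mathcal{X}\lor\mathcal{Y}$. Thus every assertion of the form $\mathcal{X}+\mathcal{Y}=\mathcal{Z}$ includes the assertion that $\mathcal{X}$ and $\mathcal{Y}$ are independent, and a triple sum $\mathcal{X}+\mathcal{Y}+\mathcal{Z}$ means $(\mathcal{X}+\mathcal{Y})+\mathcal{Z}$, including the corresponding independence. $\mathbb{P}[F\vert\mathcal{Z}]$ denotes the conditional probability of $F\in\mathcal{M}$ given $\mathcal{Z}$ (versions are a.s. equal; as all $\sigma$-fields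 are complete, measurability does not depend on the chosen version). *)

theory Defs
  imports "HOL-Probability.Probability"
begin

text \<open>Sub-\<open>\<sigma>\<close>-fields are represented by their collections of events, over the fixed
  sample space \<^term>\<open>space M\<close>. The measure \<open>M\<close> is not assumed to be complete; a sub-\<open>\<sigma>\<close>-field is
  called complete if it contains all events of probability 0 or 1.\<close>

definition trivial_events :: "'a measure \<Rightarrow> 'a set set" where
  "trivial_events M = {E \<in> sets M. measure M E \<in> {0, 1}}"

definition complete_subfields :: "'a measure \<Rightarrow> 'a set set set" where
  "complete_subfields M =
     {X. sigma_algebra (space M) X \<and> X \<subseteq> sets M \<and> trivial_events M \<subseteq> X}"

definition field_join :: "'a measure \<Rightarrow> 'a set set \<Rightarrow> 'a set set \<Rightarrow> 'a set set" where
  "field_join M X Y = sigma_sets (space M) (X \<union> Y)"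

abbreviation indep_fields :: "'a measure \<Rightarrow> 'a set set \<Rightarrow> 'a set set \<Rightarrow> bool" where
  "indep_fields M X Y \<equiv> prob_space.indep_set M X Y"

text \<open>The assertion \<open>X + Y = Z\<close>, where writing \<open>X + Y\<close> for the join includes the
  independence of \<open>X\<close> and \<open>Y\<close>.\<close>

definition is_indep_sum :: "'a measure \<Rightarrow> 'a set set \<Rightarrow> 'a set set \<Rightarrow> 'a set set \<Rightarrow> bool" where
  "is_indep_sum M X Y Z \<longleftrightarrow> indep_fields M X Y \<and> field_join M X Y = Z"

text \<open>A version of the conditional probability of \<open>F\<close> given \<open>Z\<close>. Two versions differ only on an
  event of probability 0, so measurability with respect to a complete sub-\<open>\<sigma>\<close>-field does not
  depend on the version.\<close>

definition cond_prob_given :: "'a measure \<Rightarrow> 'a set \<Rightarrow> 'a set set \<Rightarrow> 'a \<Rightarrow> real" where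
  "cond_prob_given M F Z = real_cond_exp M (sigma (space M) Z) (indicator F)"

definition field_measurable :: "'a measure \<Rightarrow> 'a set set \<Rightarrow> ('a \<Rightarrow> real) \<Rightarrow> bool" where
  "field_measurable M X f \<longleftrightarrow> f \<in> borel_measurable (sigma (space M) X)"

end

theory Submission
  imports Defs
begin

text \<open>Write \<open>W = A' \<inter> B\<close>. Everything rests on one criterion, \<open>cond_prob_join\<close>: whether conditioning an
  event \<open>K\<close> on a join \<open>U\<^sub>1 \<or> U\<^sub>2\<close> amounts to conditioning it on a smaller field \<open>V \<supseteq> U\<^sub>1\<close> can be
  tested on the intersections of events of \<open>U\<^sub>1\<close> and \<open>U\<^sub>2\<close>, where conditioning can be moved from \<open>K\<close> to
  an event of \<open>U\<^sub>2\<close> since conditional expectation is self-adjoint.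

  If \<open>A\<close> and \<open>B\<close> are independent and \<open>X \<subseteq> B\<close>, the criterion shows that \<open>P[F | A \<or> X] = P[F | X]\<close> for
  \<open>F \<in> B\<close>. This gives the modular law \<open>(A \<or> X) \<inter> B = X\<close>, hence (i) and the equivalence of (a) to (d), and
  also that (a) implies (e). Conversely, (e) makes \<open>P[F | A']\<close> measurable with respect to \<open>W\<close> for \<open>F \<in> B\<close>,
  and by the criterion \<open>P[K | A \<or> B] = P[K | A \<or> W]\<close> for \<open>K \<in> A'\<close>. As \<open>A' \<subseteq> A \<or> B\<close>, this
  forces \<open>A' = A \<or> W\<close>; in the same way \<open>B = B' \<or> W\<close>.\<close>

section \<open>The lattice of complete sub-\<sigma>-fields\<close>

lemma complete_subfieldsD:
  assumes "V \<in> complete_subfields M"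
  shows "sigma_algebra (space M) V" "V \<subseteq> sets M" "sets (sigma (space M) V) = V"
    "subalgebra M (sigma (space M) V)"
proof -
  show sa: "sigma_algebra (space M) V" and sub: "V \<subseteq> sets M"
    using assms by (auto simp: complete_subfields_def)
  show s: "sets (sigma (space M) V) = V"
    by (rule sigma_algebra.sets_measure_of_eq[OF sa])
  show "subalgebra M (sigma (space M) V)"
    using s sub by (simp add: subalgebra_def space_measure_of_conv)
qed

lemma complete_subfields_Int:
  assumes "X \<in> complete_subfields M" "Y \<in> complete_subfields M"
  shows "X \<inter> Y \<in> complete_subfields M"
proof -
  interpret X: sigma_algebra "space M" X by (rule complete_subfieldsD[OF assms(1)])
  interpret Y: sigma_algebra "space M" Y by (rule complete_subfieldsD[OF assms(2)])
  have "sigma_algebra (space M) (X \<inter> Y)"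
    unfolding sigma_algebra_iff2 using X.space_closed by auto
  then show ?thesis
    using assms by (auto simp: complete_subfields_def)
qed

lemma field_join_in_complete_subfields:
  assumes "X \<in> complete_subfields M" "Y \<in> complete_subfields M"
  shows "field_join M X Y \<in> complete_subfields M"
proof -
  have "X \<union> Y \<subseteq> sets M"
    using assms by (auto simp: complete_subfields_def)
  moreover have "sigma_algebra (space M) (field_join M X Y)"
    unfolding field_join_def
    by (rule sigma_algebra_sigma_sets) (use calculation sets.space_closed in blast)
  moreover have "trivial_events M \<subseteq> field_join M X Y"
    using assms by (auto simp: complete_subfields_def field_join_def)
  ultimately show ?thesis
    using sets.sigma_sets_subset[of "X \<union> Y" M]
    by (auto simp: complete_subfields_def field_join_def)
qed

lemma field_join_upper: "X \<subseteq> field_join M X Y" "Y \<subseteq> field_join M X Y"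
  by (auto simp: field_join_def)

lemma field_join_least:
  assumes "Z \<in> complete_subfields M" "X \<subseteq> Z" "Y \<subseteq> Z"
  shows "field_join M X Y \<subseteq> Z"
  unfolding field_join_def
  by (intro sigma_algebra.sigma_sets_subset complete_subfieldsD) (use assms in auto)

lemma field_join_commute: "field_join M X Y = field_join M Y X"
  by (simp add: field_join_def Un_commute)

context prob_space
begin

section \<open>Independence, and measurability up to null events\<close>

lemma indep_set_mono:
  assumes "indep_set X Y" "X' \<subseteq> X" "Y' \<subseteq> Y"
  shows "indep_set X' Y'"
  using assms unfolding indep_sets2_eq by blast

lemma indep_set_commute: "indep_set X Y \<Longrightarrow> indep_set Y X"
  unfolding indep_sets2_eq by (metis Int_commute mult.commute)

lemma complete_subfields_sigma_finite:
  assumes "V \<in> complete_subfields M"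
  shows "sigma_finite_subalgebra M (sigma (space M) V)"
  by (intro finite_measure_subalgebra_is_sigma_finite finite_measure_subalgebra.intro
      finite_measure_axioms finite_measure_subalgebra_axioms.intro complete_subfieldsD assms)

lemma cond_prob_measurable:
  "cond_prob_given M F V \<in> borel_measurable (sigma (space M) V)"
  unfolding cond_prob_given_def by simp

lemma field_measurable_mono:
  assumes "X \<in> complete_subfields M" "Y \<in> complete_subfields M" "X \<subseteq> Y" "field_measurable M X f"
  shows "field_measurable M Y f"
  unfolding field_measurable_def
  by (rule measurable_from_subalg[OF _ assms(4)[unfolded field_measurable_def]])
    (use assms in \<open>simp add: subalgebra_def complete_subfieldsD space_measure_of_conv\<close>)

text \<open>The two one-sided differences are null events, so completeness places them in
  \<open>V\<close>, and \<open>F\<close> arises from \<open>E\<close> by removing one and adding the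
  other. This is where completeness of the fields does its work.\<close>

lemma complete_subfields_AE_eq:
  assumes V: "V \<in> complete_subfields M" and "E \<in> V" "F \<in> events"
    and ae: "AE x in M. x \<in> E \<longleftrightarrow> x \<in> F"
  shows "F \<in> V"
proof -
  interpret V: sigma_algebra "space M" V by (rule complete_subfieldsD[OF V])
  have E: "E \<in> events" using V \<open>E \<in> V\<close> complete_subfieldsD by blast
  have "prob (E - F) = 0" "prob (F - E) = 0"
    by (intro prob_eq_0[THEN iffD2] sets.Diff E \<open>F \<in> events\<close>; use ae in \<open>eventually_elim; auto\<close>)+
  then have "E - F \<in> V" "F - E \<in> V"
    using V E \<open>F \<in> events\<close> by (auto simp: complete_subfields_def trivial_events_def)
  moreover have "F = (E - (E - F)) \<union> (F - E)" by auto
  ultimately show ?thesis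
    using \<open>E \<in> V\<close> by (metis V.Diff V.Un)
qed

text \<open>Preimages under \<open>f\<close> and \<open>g\<close> differ by a null event, so the
  previous lemma applies. Since \<open>M\<close> itself may be incomplete, measurability of
  \<open>g\<close> on \<open>M\<close> is what makes its preimages events. The lemma allows passing
  between versions of a conditional probability.\<close>

lemma field_measurable_AE_eq:
  assumes V: "V \<in> complete_subfields M" and f: "field_measurable M V f"
    and g: "g \<in> borel_measurable M" and ae: "AE x in M. f x = g x"
  shows "field_measurable M V g"
  unfolding field_measurable_def
proof (rule measurableI)
  fix S :: "real set" assume S: "S \<in> sets borel"
  have "f -` S \<inter> space M \<in> V"
    using measurable_sets[OF f[unfolded field_measurable_def] S] complete_subfieldsD(3)[OF V]
    by (simp add: space_measure_of_conv)
  moreover have "g -` S \<inter> space M \<in> events"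
    using g S by (rule measurable_sets)
  moreover have "AE x in M. x \<in> f -` S \<inter> space M \<longleftrightarrow> x \<in> g -` S \<inter> space M"
    using ae by eventually_elim auto
  ultimately show "g -` S \<inter> space (sigma (space M) V) \<in> sets (sigma (space M) V)"
    using complete_subfields_AE_eq[OF V] complete_subfieldsD(3)[OF V]
    by (simp add: space_measure_of_conv)
qed simp

lemma in_field_if_indicator_AE_measurable:
  assumes V: "V \<in> complete_subfields M" and f: "field_measurable M V f"
    and K: "K \<in> events" and ae: "AE x in M. f x = indicator K x"
  shows "K \<in> V"
proof -
  have "field_measurable M V (indicator K :: _ \<Rightarrow> real)"
    by (rule field_measurable_AE_eq[OF V f _ ae]) (use K in simp)
  then have "indicator K -` {1 :: real} \<inter> space M \<in> V"
    using measurable_sets[of "indicator K" "sigma (space M) V" borel "{1 :: real}"]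
      complete_subfieldsD(3)[OF V]
    by (simp add: field_measurable_def space_measure_of_conv)
  moreover have "indicator K -` {1 :: real} \<inter> space M = K"
    using sets.sets_into_space[OF K] by (auto simp: indicator_def)
  ultimately show ?thesis by simp
qed

section \<open>Conditional probabilities of events\<close>

lemma integrable_indicator_event: "F \<in> events \<Longrightarrow> integrable M (indicator F :: _ \<Rightarrow> real)"
  by (rule integrable_real_indicator) (auto simp: emeasure_eq_measure)

lemma integrable_cond_prob:
  assumes "V \<in> complete_subfields M" "F \<in> events"
  shows "integrable M (cond_prob_given M F V)"
proof -
  interpret V: sigma_finite_subalgebra M "sigma (space M) V"
    by (rule complete_subfields_sigma_finite[OF assms(1)])
  show ?thesis
    unfolding cond_prob_given_def by (intro V.real_cond_exp_int integrable_indicator_event assms(2))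
qed

lemma set_integrable_cond_prob:
  assumes "V \<in> complete_subfields M" "F \<in> events" "E \<in> events"
  shows "set_integrable M E (cond_prob_given M F V)"
  unfolding set_integrable_def
  by (intro integrable_mult_indicator integrable_cond_prob assms)

lemma set_integral_indicator:
  assumes "E \<in> events" "F \<in> events"
  shows "(LINT x:E|M. indicator F x :: real) = prob (E \<inter> F)"
proof -
  have "(LINT x:E|M. indicator F x :: real) = (\<integral>x. indicator (E \<inter> F) x \<partial>M)"
    unfolding set_lebesgue_integral_def
    by (intro Bochner_Integration.integral_cong) (auto simp: indicator_def)
  also have "\<dots> = prob (E \<inter> F \<inter> space M)" by simp
  also have "E \<inter> F \<inter> space M = E \<inter> F" using sets.sets_into_space[OF assms(1)] by auto
  finally show ?thesis .
qed

lemma cond_prob_unique: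
  assumes V: "V \<in> complete_subfields M" and F: "F \<in> events"
    and f: "field_measurable M V f" and int: "integrable M f"
    and eq: "\<And>E. E \<in> V \<Longrightarrow> (LINT x:E|M. f x) = prob (E \<inter> F)"
  shows "AE x in M. cond_prob_given M F V x = f x"
proof -
  interpret V: sigma_finite_subalgebra M "sigma (space M) V"
    by (rule complete_subfields_sigma_finite[OF V])
  show ?thesis
    unfolding cond_prob_given_def
  proof (rule V.real_cond_exp_charact)
    fix E assume "E \<in> sets (sigma (space M) V)"
    then have "E \<in> V" using complete_subfieldsD(3)[OF V] by simp
    then show "(LINT x:E|M. indicator F x) = (LINT x:E|M. f x)"
      using eq set_integral_indicator[of E F] F complete_subfieldsD(2)[OF V] by auto
  qed (use F f int integrable_indicator_event in \<open>auto simp: field_measurable_def\<close>)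
qed

text \<open>Both sides equal the integral of the product of the two conditional probabilities,
  because an indicator may be replaced by its conditional probability when integrated against a
  function measurable for \<open>V\<close>.\<close>

lemma cond_prob_self_adjoint:
  assumes V: "V \<in> complete_subfields M" and EF: "E \<in> events" "F \<in> events"
  shows "(LINT x:E|M. cond_prob_given M F V x) = (LINT x:F|M. cond_prob_given M E V x)"
proof -
  interpret V: sigma_finite_subalgebra M "sigma (space M) V"
    by (rule complete_subfields_sigma_finite[OF V])
  have *: "(LINT x:E|M. cond_prob_given M F V x) =
      (\<integral>x. cond_prob_given M F V x * cond_prob_given M E V x \<partial>M)"
    if EF: "E \<in> events" "F \<in> events" for E F
  proof -
    have i: "integrable M (\<lambda>x. cond_prob_given M F V x * indicator E x)"
      using set_integrable_cond_prob[OF V EF(2,1)] by (simp add: set_integrable_def mult.commute)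
    have "(\<integral>x. cond_prob_given M F V x * cond_prob_given M E V x \<partial>M) =
        (\<integral>x. cond_prob_given M F V x * indicator E x \<partial>M)"
      unfolding cond_prob_given_def[of M E]
      by (rule V.real_cond_exp_intg(2)[OF i]) (use EF cond_prob_measurable in auto)
    then show ?thesis
      by (simp add: set_lebesgue_integral_def mult.commute)
  qed
  show ?thesis
    using *[OF EF] *[OF EF(2,1)] by (simp add: mult.commute)
qed

section \<open>Taking out known events; conditioning on a join\<close>

lemma cond_prob_Int:
  assumes V: "V \<in> complete_subfields M" and E: "E \<in> V" and F: "F \<in> events"
  shows "AE x in M. cond_prob_given M (E \<inter> F) V x = indicator E x * cond_prob_given M F V x"
proof -
  interpret V: sigma_finite_subalgebra M "sigma (space M) V"
    by (rule complete_subfields_sigma_finite[OF V])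
  have E': "E \<in> events" using V E complete_subfieldsD by blast
  have ind: "indicator (E \<inter> F) = (\<lambda>x. indicator E x * indicator F x :: real)"
    by (auto simp: indicator_def)
  have "integrable M (indicator (E \<inter> F) :: 'a \<Rightarrow> real)"
    using E' F by (intro integrable_indicator_event) auto
  then show ?thesis
    unfolding cond_prob_given_def ind
    by (intro V.real_cond_exp_mult borel_measurable_indicator)
      (use E F complete_subfieldsD(3)[OF V] in auto)
qed

text \<open>A Dynkin argument over the intersections \<open>E \<inter> F\<close>, which form an
  intersection-stable generator of the join. On such a set, self-adjointness moves the conditioning
  from \<open>K\<close> to \<open>E \<inter> F\<close>, and \<open>E\<close> factors out because
  \<open>U1 \<subseteq> V\<close>; what remains is \<open>gen\<close>.\<close>

lemma set_integral_cond_prob_join: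
  assumes V: "V \<in> complete_subfields M"
    and U1: "U1 \<in> complete_subfields M" and U2: "U2 \<in> complete_subfields M"
    and sub: "U1 \<subseteq> V" and K: "K \<in> events"
    and gen: "\<And>E F. E \<in> U1 \<Longrightarrow> F \<in> U2 \<Longrightarrow>
      (LINT x:E \<inter> K|M. cond_prob_given M F V x) = prob (E \<inter> F \<inter> K)"
    and H: "H \<in> field_join M U1 U2"
  shows "(LINT x:H|M. cond_prob_given M K V x) = prob (H \<inter> K)"
proof -
  interpret U1: sigma_algebra "space M" U1 by (rule complete_subfieldsD[OF U1])
  interpret U2: sigma_algebra "space M" U2 by (rule complete_subfieldsD[OF U2])
  interpret V: sigma_algebra "space M" V by (rule complete_subfieldsD[OF V])
  interpret V: sigma_finite_subalgebra M "sigma (space M) V"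
    by (rule complete_subfields_sigma_finite[OF V])
  let ?f = "cond_prob_given M K V"
  define G where "G = {E \<inter> F |E F. E \<in> U1 \<and> F \<in> U2}"
  have U_events: "U1 \<subseteq> events" "U2 \<subseteq> events"
    using U1 U2 complete_subfieldsD by blast+
  have G_events: "G \<subseteq> events"
    using U_events by (auto simp: G_def)
  have [simp]: "integrable M ?f" by (rule integrable_cond_prob[OF V K])
  have si: "set_integrable M E ?f" if "E \<in> events" for E
    using that by (rule set_integrable_cond_prob[OF V K])
  have G_Pow: "G \<subseteq> Pow (space M)"
    using G_events sets.space_closed by blast
  have "Int_stable G"
  proof (rule Int_stableI)
    fix a b assume "a \<in> G" "b \<in> G"
    then obtain E F E' F' where "a = E \<inter> F" "b = E' \<inter> F'" "E \<in> U1" "F \<in> U2" "E' \<in> U1" "F' \<in> U2"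
      by (auto simp: G_def)
    then have "a \<inter> b = (E \<inter> E') \<inter> (F \<inter> F')" "E \<inter> E' \<in> U1" "F \<inter> F' \<in> U2" by auto
    then show "a \<inter> b \<in> G" unfolding G_def by blast
  qed
  have "U1 \<union> U2 \<subseteq> G"
  proof
    fix E assume "E \<in> U1 \<union> U2"
    moreover have "E = E \<inter> space M" "E = space M \<inter> E"
      using calculation U1.space_closed U2.space_closed by auto
    ultimately show "E \<in> G" unfolding G_def using U1.top U2.top by blast
  qed
  then have "H \<in> sigma_sets (space M) G"
    using H sigma_sets_mono'[of "U1 \<union> U2" G "space M"] unfolding field_join_def by blast
  from \<open>Int_stable G\<close> G_Pow this show ?thesis
  proof (induction rule: sigma_sets_induct_disjoint)
    case (basic H)
    then obtain E F where H: "H = E \<inter> F" and EF: "E \<in> U1" "F \<in> U2" by (auto simp: G_def)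
    have "(LINT x:H|M. ?f x) = (LINT x:K|M. cond_prob_given M (E \<inter> F) V x)"
      unfolding H by (rule cond_prob_self_adjoint[OF V]) (use EF U_events K in auto)
    also have "\<dots> = (\<integral>x. indicator K x *\<^sub>R (indicator E x * cond_prob_given M F V x) \<partial>M)"
      unfolding set_lebesgue_integral_def
    proof (rule integral_cong_AE)
      have "cond_prob_given M L V \<in> borel_measurable M" for L
        unfolding cond_prob_given_def by simp
      moreover have "E \<in> events" using EF U_events by auto
      ultimately show "(\<lambda>x. indicator K x *\<^sub>R cond_prob_given M (E \<inter> F) V x) \<in> borel_measurable M"
        "(\<lambda>x. indicator K x *\<^sub>R (indicator E x * cond_prob_given M F V x)) \<in> borel_measurable M"
        using K by auto
      show "AE x in M. indicator K x *\<^sub>R cond_prob_given M (E \<inter> F) V x =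
          indicator K x *\<^sub>R (indicator E x * cond_prob_given M F V x)"
        using cond_prob_Int[OF V subsetD[OF sub EF(1)] subsetD[OF U_events(2) EF(2)]]
        by eventually_elim simp
    qed
    also have "\<dots> = (LINT x:E \<inter> K|M. cond_prob_given M F V x)"
      unfolding set_lebesgue_integral_def
      by (intro Bochner_Integration.integral_cong) (auto simp: indicator_def)
    also have "\<dots> = prob (H \<inter> K)" using gen[OF EF] by (simp add: H)
    finally show ?case .
  next
    case empty
    show ?case by (simp add: set_lebesgue_integral_def)
  next
    case (compl H)
    have H: "H \<in> events" using compl(1) sets.sigma_sets_subset[OF G_events] by auto
    \<comment> \<open>The complement case needs the total integral, which is the averaging property
      on the event \<open>space M\<close>.\<close>
    have "space M \<in> V" by simp
    then have tot: "(LINT x:space M|M. ?f x) = prob K"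
      using V.real_cond_exp_intA[of "indicator K" "space M"] K set_integral_indicator[of "space M" K]
        complete_subfieldsD(3)[OF V] sets.Int_space_eq1[OF K]
      by (simp add: cond_prob_given_def emeasure_eq_measure)
    have "(LINT x:H \<union> (space M - H)|M. ?f x) = (LINT x:H|M. ?f x) + (LINT x:space M - H|M. ?f x)"
      by (rule set_integral_Un) (use H si in auto)
    moreover have "H \<union> (space M - H) = space M" using sets.sets_into_space[OF H] by auto
    ultimately have "(LINT x:space M - H|M. ?f x) = prob K - prob (H \<inter> K)"
      using compl tot by simp
    also have "\<dots> = prob (K - H)"
      using finite_measure_Diff'[OF K H] by (simp add: Int_commute)
    also have "K - H = (space M - H) \<inter> K" using sets.sets_into_space[OF K] by auto
    finally show ?case .
  next
    case (union H)
    have H: "H i \<in> events" for i using union(2) sets.sigma_sets_subset[OF G_events] by auto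
    have "(LINT x:(\<Union>i. H i)|M. ?f x) = (\<Sum>i. LINT x:H i|M. ?f x)"
      by (rule lebesgue_integral_countable_add)
        (use H union(1) si in \<open>auto simp: disjoint_family_on_def\<close>)
    also have "\<dots> = (\<Sum>i. prob (H i \<inter> K))" using union by simp
    also have "\<dots> = prob (\<Union>i. H i \<inter> K)"
      by (intro sums_unique[symmetric] finite_measure_UNION)
        (use H K union(1) in \<open>auto simp: disjoint_family_on_def\<close>)
    finally show ?case by simp
  qed
qed

text \<open>The inclusion of \<open>V\<close> in the join makes the conditional probability given
  \<open>V\<close> measurable for the join, and the preceding lemma supplies its integrals;
  uniqueness then identifies the two.\<close>

lemma cond_prob_join:
  assumes V: "V \<in> complete_subfields M"
    and U: "U1 \<in> complete_subfields M" "U2 \<in> complete_subfields M"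
    and sub: "U1 \<subseteq> V" "V \<subseteq> field_join M U1 U2" and K: "K \<in> events"
    and gen: "\<And>E F. E \<in> U1 \<Longrightarrow> F \<in> U2 \<Longrightarrow>
      (LINT x:E \<inter> K|M. cond_prob_given M F V x) = prob (E \<inter> F \<inter> K)"
  shows "AE x in M. cond_prob_given M K (field_join M U1 U2) x = cond_prob_given M K V x"
proof (rule cond_prob_unique[OF _ K])
  show J: "field_join M U1 U2 \<in> complete_subfields M"
    by (rule field_join_in_complete_subfields[OF U])
  show "field_measurable M (field_join M U1 U2) (cond_prob_given M K V)"
    by (rule field_measurable_mono[OF V J sub(2)])
      (simp add: field_measurable_def cond_prob_measurable)
  show "integrable M (cond_prob_given M K V)"
    by (rule integrable_cond_prob[OF V K])
qed (rule set_integral_cond_prob_join[OF V U sub(1) K gen])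

section \<open>Membership tests and independent fields\<close>

lemma cond_prob_of_member:
  assumes "V \<in> complete_subfields M" "F \<in> V"
  shows "AE x in M. cond_prob_given M F V x = indicator F x"
proof (rule cond_prob_unique)
  have F: "F \<in> events" using assms complete_subfieldsD by blast
  then show "integrable M (indicator F :: _ \<Rightarrow> real)"
    by (rule integrable_indicator_event)
  show "field_measurable M V (indicator F)"
    unfolding field_measurable_def
    using assms complete_subfieldsD(3) by (intro borel_measurable_indicator) auto
  show "(LINT x:E|M. indicator F x :: real) = prob (E \<inter> F)" if "E \<in> V" for E
    using that F assms(1) complete_subfieldsD(2) by (intro set_integral_indicator) auto
qed (use assms complete_subfieldsD in blast)+

text \<open>Conditioning on a field containing \<open>K\<close> returns the indicator of
  \<open>K\<close>, so the a.e. equality gives this indicator a version measurable for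
  \<open>V\<close>. Both \<open>field_join_Int_indep\<close> and
  \<open>subset_join_Int_of_cond_prob_measurable\<close> obtain their inclusion this way.\<close>

lemma in_field_if_cond_prob_AE_eq:
  assumes U: "U \<in> complete_subfields M" and V: "V \<in> complete_subfields M" and K: "K \<in> U"
    and ae: "AE x in M. cond_prob_given M K U x = cond_prob_given M K V x"
  shows "K \<in> V"
proof (rule in_field_if_indicator_AE_measurable[OF V])
  show "field_measurable M V (cond_prob_given M K V)"
    by (simp add: field_measurable_def cond_prob_measurable)
  show "K \<in> events" using U K complete_subfieldsD by blast
  show "AE x in M. cond_prob_given M K V x = indicator K x"
    using ae cond_prob_of_member[OF U K] by eventually_elim simp
qed

lemma cond_prob_indep:
  assumes V: "V \<in> complete_subfields M" and ind: "indep_set U V" and F: "F \<in> U"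
  shows "AE x in M. cond_prob_given M F V x = prob F"
proof (rule cond_prob_unique[OF V])
  show "F \<in> events" using ind F indep_setD_ev1 by blast
  show "field_measurable M V (\<lambda>x. prob F)" by (simp add: field_measurable_def)
  show "integrable M (\<lambda>x. prob F)" by simp
  fix E assume "E \<in> V"
  then have "E \<in> events" using complete_subfieldsD[OF V] by auto
  then have "(LINT x:E|M. prob F) = prob E * prob F"
    by (simp add: set_lebesgue_integral_def)
  also have "\<dots> = prob (E \<inter> F)"
    using indep_setD[OF ind F \<open>E \<in> V\<close>] by (simp add: Int_commute mult.commute)
  finally show "(LINT x:E|M. prob F) = prob (E \<inter> F)" .
qed

text \<open>The criterion is used with \<open>U1 = V = X\<close> and \<open>U2 = A\<close>, hence
  the commuted join. For \<open>F \<in> A\<close> the conditional probability given \<open>X\<close>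
  is the constant \<open>prob F\<close>, and \<open>E \<inter> K\<close> lies in \<open>B\<close>,
  so independence of \<open>A\<close> and \<open>B\<close> gives the product required.\<close>

lemma cond_prob_join_indep:
  assumes A: "A \<in> complete_subfields M" and B: "B \<in> complete_subfields M"
    and X: "X \<in> complete_subfields M"
    and ind: "indep_set A B" and sub: "X \<subseteq> B" and K: "K \<in> B"
  shows "AE x in M. cond_prob_given M K (field_join M A X) x = cond_prob_given M K X x"
  unfolding field_join_commute[of M A X]
proof (rule cond_prob_join[OF X X A order_refl field_join_upper(1)])
  interpret B: sigma_algebra "space M" B by (rule complete_subfieldsD[OF B])
  show K': "K \<in> events" using B K complete_subfieldsD by blast
  fix E F assume E: "E \<in> X" and F: "F \<in> A"
  have "E \<inter> K \<in> B" using E K sub by blast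
  then have EK: "E \<inter> K \<in> events" using complete_subfieldsD[OF B] by blast
  have "AE x in M. cond_prob_given M F X x = prob F"
    by (rule cond_prob_indep[OF X indep_set_mono[OF ind order_refl sub] F])
  then have "(LINT x:E \<inter> K|M. cond_prob_given M F X x) = (LINT x:E \<inter> K|M. prob F)"
    unfolding set_lebesgue_integral_def
    by (intro integral_cong_AE) (use EK in \<open>auto simp: cond_prob_given_def\<close>)
  also have "\<dots> = prob F * prob (E \<inter> K)"
    using EK by (simp add: set_lebesgue_integral_def)
  also have "\<dots> = prob (F \<inter> (E \<inter> K))"
    using indep_setD[OF ind F \<open>E \<inter> K \<in> B\<close>] by simp
  also have "F \<inter> (E \<inter> K) = E \<inter> F \<inter> K" by auto
  finally show "(LINT x:E \<inter> K|M. cond_prob_given M F X x) = prob (E \<inter> F \<inter> K)" .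
qed

text \<open>A modular law: for an event of \<open>B\<close>, adjoining the independent field
  \<open>A\<close> to \<open>X\<close> does not change its conditional probability, so if it lies in
  the join it already lies in \<open>X\<close>.\<close>

lemma field_join_Int_indep:
  assumes A: "A \<in> complete_subfields M" and B: "B \<in> complete_subfields M"
    and X: "X \<in> complete_subfields M" and ind: "indep_set A B" and sub: "X \<subseteq> B"
  shows "field_join M A X \<inter> B = X"
proof
  have "K \<in> X" if "K \<in> field_join M A X" "K \<in> B" for K
    by (rule in_field_if_cond_prob_AE_eq[OF field_join_in_complete_subfields[OF A X] X that(1)
          cond_prob_join_indep[OF A B X ind sub that(2)]])
  then show "field_join M A X \<inter> B \<subseteq> X" by blast
  show "X \<subseteq> field_join M A X \<inter> B"
    using sub field_join_upper(2)[of X M A] by blast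
qed

text \<open>The second sum forces \<open>X \<subseteq> B\<close>, and then the modular law recovers
  \<open>X\<close> from \<open>A'\<close> by intersecting with \<open>B\<close>.\<close>

lemma indep_sum_unique:
  assumes A: "A \<in> complete_subfields M" and B: "B \<in> complete_subfields M"
    and X: "X \<in> complete_subfields M" and ind: "indep_set A B"
    and "is_indep_sum M A X A'" "is_indep_sum M B' X B"
  shows "X = A' \<inter> B"
proof -
  have "field_join M A X = A'" "X \<subseteq> B"
    using assms(5,6) field_join_upper(2)[of X M B'] by (auto simp: is_indep_sum_def)
  then show ?thesis
    using field_join_Int_indep[OF A B X ind] by simp
qed

text \<open>One half of (a) implies (e). As \<open>A'\<close> is the join of \<open>A\<close> and
  \<open>Z\<close>, conditioning \<open>F\<close> on \<open>A'\<close> amounts to conditioning on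
  \<open>Z\<close>, which is contained in \<open>B\<close>.\<close>

lemma field_measurable_cond_prob_of_indep_sum:
  assumes A: "A \<in> complete_subfields M" and B: "B \<in> complete_subfields M"
    and Z: "Z \<in> complete_subfields M" and ind: "indep_set A B" and sub: "Z \<subseteq> B"
    and sum: "is_indep_sum M A Z A'" and F: "F \<in> B"
  shows "field_measurable M B (cond_prob_given M F A')"
proof (rule field_measurable_AE_eq[OF B])
  show "field_measurable M B (cond_prob_given M F Z)"
    by (rule field_measurable_mono[OF Z B sub])
      (simp add: field_measurable_def cond_prob_measurable)
  show "cond_prob_given M F A' \<in> borel_measurable M" by (simp add: cond_prob_given_def)
  have "AE x in M. cond_prob_given M F (field_join M A Z) x = cond_prob_given M F Z x"
    by (rule cond_prob_join_indep[OF A B Z ind sub F])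
  then show "AE x in M. cond_prob_given M F Z x = cond_prob_given M F A' x"
    using sum by (auto simp: is_indep_sum_def)
qed

text \<open>One half of (e) implies (a), with \<open>C\<close> in the role of \<open>A'\<close>. The
  measurability assumption turns conditioning events of \<open>B\<close> on \<open>C\<close> into
  conditioning on \<open>?V\<close>; the join criterion transfers this to events \<open>K\<close> of
  \<open>C\<close>, whose conditional probabilities given \<open>?J\<close> and \<open>?V\<close>
  then agree.\<close>

lemma subset_join_Int_of_cond_prob_measurable:
  assumes A: "A \<in> complete_subfields M" and B: "B \<in> complete_subfields M"
    and C: "C \<in> complete_subfields M"
    and AC: "A \<subseteq> C" and C_join: "C \<subseteq> field_join M A B"
    and meas: "\<And>F. F \<in> B \<Longrightarrow> field_measurable M B (cond_prob_given M F C)"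
  shows "C \<subseteq> field_join M A (C \<inter> B)"
proof
  interpret C: sigma_algebra "space M" C by (rule complete_subfieldsD[OF C])
  let ?W = "C \<inter> B" and ?V = "field_join M A (C \<inter> B)" and ?J = "field_join M A B"
  have W: "?W \<in> complete_subfields M" by (rule complete_subfields_Int[OF C B])
  have V: "?V \<in> complete_subfields M" by (rule field_join_in_complete_subfields[OF A W])
  have J: "?J \<in> complete_subfields M" by (rule field_join_in_complete_subfields[OF A B])
  have VC: "?V \<subseteq> C" by (rule field_join_least[OF C AC]) simp
  have VJ: "?V \<subseteq> ?J" using VC C_join by simp
  have C_events: "C \<subseteq> events" by (rule complete_subfieldsD[OF C])
  fix K assume K: "K \<in> C"
  show "K \<in> ?V"
  proof (rule in_field_if_cond_prob_AE_eq[OF J V])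
    show "K \<in> ?J" using K C_join by blast
    show "AE x in M. cond_prob_given M K ?J x = cond_prob_given M K ?V x"
    proof (rule cond_prob_join[OF V A B field_join_upper(1) VJ])
      show "K \<in> events" using K C_events by blast
      fix E F assume E: "E \<in> A" and F: "F \<in> B"
      have F': "F \<in> events" using F complete_subfieldsD[OF B] by blast
      interpret C': sigma_finite_subalgebra M "sigma (space M) C"
        by (rule complete_subfields_sigma_finite[OF C])
      have C_int: "(LINT x:D|M. cond_prob_given M F C x) = prob (D \<inter> F)" if "D \<in> C" for D
        using C'.real_cond_exp_intA[of "indicator F" D] that F' set_integral_indicator[of D F]
          complete_subfieldsD(3)[OF C] C_events
        by (auto simp: cond_prob_given_def emeasure_eq_measure)
      \<comment> \<open>One and the same version is measurable for \<open>C\<close> by construction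
        and for \<open>B\<close> by assumption, so its preimages lie in the intersection.\<close>
      have "field_measurable M ?W (cond_prob_given M F C)"
        using meas[OF F] cond_prob_measurable[of F C]
        by (simp add: field_measurable_def measurable_def space_measure_of_conv
            complete_subfieldsD(3)[OF B] complete_subfieldsD(3)[OF C] complete_subfieldsD(3)[OF W])
      then have "field_measurable M ?V (cond_prob_given M F C)"
        by (rule field_measurable_mono[OF W V field_join_upper(2)])
      \<comment> \<open>Since \<open>?V \<subseteq> C\<close>, this version also has the correct
        integrals over the events of \<open>?V\<close>.\<close>
      then have ae: "AE x in M. cond_prob_given M F ?V x = cond_prob_given M F C x"
        by (rule cond_prob_unique[OF V F' _ integrable_cond_prob[OF C F']])
          (rule C_int, use VC in blast)
      have EK: "E \<inter> K \<in> C" using E K AC by blast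
      have "(LINT x:E \<inter> K|M. cond_prob_given M F ?V x) = (LINT x:E \<inter> K|M. cond_prob_given M F C x)"
        unfolding set_lebesgue_integral_def
        by (intro integral_cong_AE) (use ae EK C_events in \<open>auto simp: cond_prob_given_def\<close>)
      also have "\<dots> = prob (E \<inter> F \<inter> K)"
        using C_int[OF EK] by (simp add: Int_ac)
      finally show "(LINT x:E \<inter> K|M. cond_prob_given M F ?V x) = prob (E \<inter> F \<inter> K)" .
    qed
  qed
qed

end

section \<open>Uniqueness and the five equivalent conditions\<close>

theorem proposition3p27:
  fixes M :: "'a measure" and A B A' B' :: "'a set set"
  assumes "prob_space M"
    and "A \<in> complete_subfields M" and "B \<in> complete_subfields M"
    and "A' \<in> complete_subfields M" and "B' \<in> complete_subfields M"
    and "indep_fields M A B" and "indep_fields M A' B'"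
    and "field_join M A B = field_join M A' B'"
  shows
    "(\<forall>X \<in> complete_subfields M.
        is_indep_sum M A X A' \<and> is_indep_sum M B' X B \<longrightarrow> X = A' \<inter> B)
     \<and>
     (\<forall>X \<in> complete_subfields M. \<forall>Y \<in> complete_subfields M.
        is_indep_sum M A X A' \<and> is_indep_sum M B' Y B \<longrightarrow>
        (let
           a = (\<exists>Z \<in> complete_subfields M. is_indep_sum M A Z A' \<and> is_indep_sum M B' Z B);
           b = (indep_fields M A (A' \<inter> B) \<and>
                is_indep_sum M (field_join M A (A' \<inter> B)) B' (field_join M A B));
           c = (X \<subseteq> field_join M A (A' \<inter> B) \<and> Y \<subseteq> field_join M B' (A' \<inter> B));
           d = ((\<exists>X' \<in> complete_subfields M. X' \<subseteq> B \<and> is_indep_sum M A X' A') \<and>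
                (\<exists>Y' \<in> complete_subfields M. Y' \<subseteq> A' \<and> is_indep_sum M B' Y' B));
           e = ((\<forall>F \<in> B. field_measurable M B (cond_prob_given M F A')) \<and>
                (\<forall>F \<in> A'. field_measurable M A' (cond_prob_given M F B)))
         in (a \<longleftrightarrow> b) \<and> (a \<longleftrightarrow> c) \<and> (a \<longleftrightarrow> d) \<and> (a \<longleftrightarrow> e)))"
proof -
  interpret prob_space M by fact
  note A = assms(2) and B = assms(3) and A' = assms(4) and B' = assms(5)
  note AB = assms(6) and A'B' = assms(7) and join = assms(8)
  let ?W = "A' \<inter> B"
  have W: "?W \<in> complete_subfields M" by (rule complete_subfields_Int[OF A' B])
  have uniq: "X = ?W"
    if "X \<in> complete_subfields M" "is_indep_sum M A X A'" "is_indep_sum M B' X B" for X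
    using that by (intro indep_sum_unique[OF A B _ AB])
  have equiv: "(a \<longleftrightarrow> b) \<and> (a \<longleftrightarrow> c) \<and> (a \<longleftrightarrow> d) \<and> (a \<longleftrightarrow> e)"
    if XY: "is_indep_sum M A X A' \<and> is_indep_sum M B' Y B"
      and a_def: "a \<longleftrightarrow> (\<exists>Z \<in> complete_subfields M. is_indep_sum M A Z A' \<and> is_indep_sum M B' Z B)"
      and b_def: "b \<longleftrightarrow> indep_set A ?W \<and> is_indep_sum M (field_join M A ?W) B' (field_join M A B)"
      and c_def: "c \<longleftrightarrow> X \<subseteq> field_join M A ?W \<and> Y \<subseteq> field_join M B' ?W"
      and d_def: "d \<longleftrightarrow> (\<exists>X' \<in> complete_subfields M. X' \<subseteq> B \<and> is_indep_sum M A X' A') \<and>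
        (\<exists>Y' \<in> complete_subfields M. Y' \<subseteq> A' \<and> is_indep_sum M B' Y' B)"
      and e_def: "e \<longleftrightarrow> (\<forall>F \<in> B. field_measurable M B (cond_prob_given M F A')) \<and>
        (\<forall>F \<in> A'. field_measurable M A' (cond_prob_given M F B))"
    for X Y a b c d e
  proof -
    \<comment> \<open>Exchanging \<open>A\<close> with \<open>B'\<close> and \<open>A'\<close> with
      \<open>B\<close> preserves the hypotheses up to the order of factors and fixes
      \<open>?W\<close>, so most claims come in mirrored pairs.\<close>
    have AW: "indep_set A ?W" by (rule indep_set_mono[OF AB]) auto
    have B'W: "indep_set B' ?W" by (rule indep_set_mono[OF indep_set_commute[OF A'B']]) auto
    have AX: "field_join M A X = A'" and BY: "field_join M B' Y = B"
      using XY by (auto simp: is_indep_sum_def)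
    have sub: "A \<subseteq> A'" "B' \<subseteq> B"
      using AX BY field_join_upper(1) by blast+
    have upper: "field_join M A ?W \<subseteq> A'" "field_join M B' ?W \<subseteq> B"
      by (rule field_join_least[OF A' sub(1)], blast) (rule field_join_least[OF B sub(2)], blast)
    \<comment> \<open>By uniqueness \<open>?W\<close> is the only possible witness in (a).\<close>
    have a_iff: "a \<longleftrightarrow> is_indep_sum M A ?W A' \<and> is_indep_sum M B' ?W B"
      unfolding a_def using uniq W by blast
    \<comment> \<open>Independence and the reverse inclusions hold automatically, so every
      implication towards (a) reduces to these two inclusions.\<close>
    have aI: "a" if "A' \<subseteq> field_join M A ?W" "B \<subseteq> field_join M B' ?W"
      unfolding a_iff is_indep_sum_def using that upper AW B'W by blast
    have aD: "field_join M A ?W = A'" "field_join M B' ?W = B" if a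
      using that by (auto simp: a_iff is_indep_sum_def)
    have "a \<longleftrightarrow> b"
    proof
      assume a
      \<comment> \<open>Under (a) the join of \<open>A\<close> and \<open>?W\<close> is
        \<open>A'\<close>, so its independence from \<open>B'\<close> is a hypothesis.\<close>
      then show b
        unfolding b_def using AW A'B' join aD by (simp add: is_indep_sum_def)
    next
      assume b
      then have b: "field_join M (field_join M A ?W) B' = field_join M A B"
        by (simp add: b_def is_indep_sum_def)
      have AW_in: "field_join M A ?W \<in> complete_subfields M"
        and B'W_in: "field_join M B' ?W \<in> complete_subfields M"
        by (auto intro: field_join_in_complete_subfields A B' W)
      \<comment> \<open>Intersecting with \<open>A'\<close> and applying the modular law to
        \<open>B'\<close> and \<open>A'\<close> removes \<open>B'\<close> from the right-hand
        side.\<close>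
      have "A' \<subseteq> field_join M B' (field_join M A ?W)"
        using b join field_join_upper(1)[of A' M B']
        by (simp add: field_join_commute[of M B'])
      with field_join_Int_indep[OF B' A' AW_in indep_set_commute[OF A'B'] upper(1)]
      have 1: "A' \<subseteq> field_join M A ?W" by blast
      \<comment> \<open>Reassociating moves \<open>?W\<close> to the side of \<open>B'\<close>, so
        that the modular law for \<open>A\<close> and \<open>B\<close> can remove
        \<open>A\<close>.\<close>
      have "field_join M (field_join M A ?W) B' \<subseteq> field_join M A (field_join M B' ?W)"
        using field_join_upper[where M = M and X = A and Y = "field_join M B' ?W"]
          field_join_upper[where M = M and X = B' and Y = ?W]
        by (intro field_join_least field_join_in_complete_subfields[OF A B'W_in]
            field_join_in_complete_subfields[OF A W]) blast+
      then have "B \<subseteq> field_join M A (field_join M B' ?W)"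
        using b field_join_upper(2) by blast
      with field_join_Int_indep[OF A B B'W_in AB upper(2)]
      have "B \<subseteq> field_join M B' ?W" by blast
      with 1 show a by (rule aI)
    qed
    moreover have "a \<longleftrightarrow> c"
    proof
      assume a
      then show c
        unfolding c_def
        using aD AX BY field_join_upper(2)[of X M A] field_join_upper(2)[of Y M B'] by simp
    next
      assume c
      then have "field_join M A X \<subseteq> field_join M A ?W" "field_join M B' Y \<subseteq> field_join M B' ?W"
        unfolding c_def
        by (intro field_join_least field_join_in_complete_subfields A B' W field_join_upper(1); blast)+
      then show a using AX BY aI by simp
    qed
    moreover have "a \<longleftrightarrow> d"
    proof
      assume a
      then show d unfolding d_def using a_iff W by (intro conjI bexI[of _ ?W]) auto
    next
      assume d
      then obtain X' Y' where X': "X' \<subseteq> B" "field_join M A X' = A'"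
        and Y': "Y' \<subseteq> A'" "field_join M B' Y' = B"
        by (auto simp: d_def is_indep_sum_def)
      then have "X' \<subseteq> ?W" "Y' \<subseteq> ?W"
        using field_join_upper(2)[of X' M A] field_join_upper(2)[of Y' M B'] by blast+
      then have "field_join M A X' \<subseteq> field_join M A ?W" "field_join M B' Y' \<subseteq> field_join M B' ?W"
        unfolding field_join_def by (intro sigma_sets_mono'; blast)+
      then show a using X' Y' aI by simp
    qed
    moreover have "a \<longleftrightarrow> e"
    proof
      assume a
      then have "is_indep_sum M A ?W A'" "is_indep_sum M B' ?W B" by (auto simp: a_iff)
      then show e
        unfolding e_def using field_measurable_cond_prob_of_indep_sum[OF A B W AB]
          field_measurable_cond_prob_of_indep_sum[OF B' A' W indep_set_commute[OF A'B']]
        by blast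
    next
      assume e
      \<comment> \<open>The inclusion lemma is applied to \<open>A\<close>, \<open>B\<close>,
        \<open>A'\<close> and, mirrored, to \<open>B'\<close>, \<open>A'\<close>,
        \<open>B\<close>.\<close>
      have "A' \<subseteq> field_join M A B" "B \<subseteq> field_join M B' A'"
        using join field_join_upper(1)[of A' M B'] field_join_upper(2)[of B M A]
        by (simp_all add: field_join_commute[of M B'])
      then have "A' \<subseteq> field_join M A (A' \<inter> B)" "B \<subseteq> field_join M B' (B \<inter> A')"
        using \<open>e\<close> unfolding e_def
        by (intro subset_join_Int_of_cond_prob_measurable A B A' B' sub; blast)+
      then show a by (intro aI) (simp_all add: Int_commute)
    qed
    ultimately show ?thesis by blast
  qed
  show ?thesis
    unfolding Let_def
  proof (intro conjI[of "\<forall>X\<in>_. _ X"] ballI impI)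
    fix X
    assume "X \<in> complete_subfields M" "is_indep_sum M A X A' \<and> is_indep_sum M B' X B"
    then show "X = ?W" by (elim conjE) (rule uniq)
  qed (rule equiv[OF _ refl refl refl refl refl])
qed

end
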